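(* Let $p$ be a prime number and let $R$ be a finite rng whose underlying additive group $(R,+)$ has exponent $p$, so that $(R,+)\cong (\mathbb{Z}/p\mathbb{Z})^N$ for some positive integer $N$. Let $n,r$ be positive integers and let $f_1,\dots,f_r\in R[t_1,\dots,t_n]$ be nonzero polynomials. Put $Z:=\{x\in R^n \mid f_1(x)=0,\dots,f_r(x)=0\}$. Then $$\operatorname{ord}_p(\#Z)\;\ge\;\left\lceil \frac{N\bigl(n-\sum_{j=1}^r\deg(f_j)\bigr)}{\max_{1\le j\le r}\deg(f_j)}\right\rceil .$$
   Context: A rng is an associative ring that need not have a multiplicative identity (and need not be commutative). Elements of $R[t_1,\dots,t_n]$ are finite sums of monomial terms $c\,t_1^{d_1}\cdots t_n^{d_n}$ with $c\in R$ and $d_i$ non-negative integers; such a term is evaluated at $(x_1,\dots,x_n)\in R^n$ as the product $c\,x_1^{d_1}\cdots x_n^{d_n}$ (factors with $d_i=0$ are omitted), and $f(x)$ is the sum of these values. $\deg$ is the total degree. For a nonzero integer $m$, $\operatorname{ord}_p(m)$ is the exponent of the largest power of $p$ dividing $m$, and $\operatorname{ord}_p(0)=\infty$. If the maximum in the denominator is $0$ (all $f_j$ are nonzero constants), the right-hand side is read as $+\infty$. *)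

theory Defs
  imports
    "HOL-Computational_Algebra.Primes"
    "HOL-Library.Poly_Mapping"
    "HOL-Library.Extended_Real"
    "HOL-Library.FuncSet"
    "HOL-Algebra.Product_Groups"
begin

text \<open>
  The type class \<^class>\<open>Rings.ring\<close> assumes neither a multiplicative identity nor
  commutativity of multiplication, i.e. it is the class of rngs.
\<close>

definition additive_group :: "'a::ab_group_add monoid" where
  "additive_group = \<lparr>carrier = UNIV, monoid.mult = (+), one = 0\<rparr>"

definition group_exponent :: "('a, 'b) monoid_scheme \<Rightarrow> nat" where
  "group_exponent G =
    (LEAST k. 0 < k \<and> (\<forall>x\<in>carrier G. x [^]\<^bsub>G\<^esub> k = \<one>\<^bsub>G\<^esub>))"

text \<open>
  A polynomial maps the exponent vector of a monomial to its coefficient; both maps have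
  finite support. The variables are indexed from 1.
\<close>

type_synonym 'a mpoly = "(nat \<Rightarrow>\<^sub>0 nat) \<Rightarrow>\<^sub>0 'a"

definition mpolys :: "nat \<Rightarrow> 'a::zero mpoly set" where
  "mpolys n = {f. \<forall>m\<in>Poly_Mapping.keys f. Poly_Mapping.keys m \<subseteq> {1..n}}"

definition total_degree :: "'a::zero mpoly \<Rightarrow> nat" where
  "total_degree f = Max (insert 0 ((\<lambda>m. \<Sum>i\<in>Poly_Mapping.keys m. Poly_Mapping.lookup m i) ` Poly_Mapping.keys f))"

text \<open>
  Without a multiplicative identity the power \<open>y\<^sup>0\<close> is not available, so \<open>c y\<^sup>d\<close> is formed
  by multiplying \<open>c\<close> on the right by \<open>y\<close> a total of \<open>d\<close> times. The variables are processed
  in increasing order of their index, which matters as multiplication need not commute.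
\<close>

definition times_power :: "'a::times \<Rightarrow> 'a \<Rightarrow> nat \<Rightarrow> 'a" where
  "times_power c y d = ((\<lambda>z. z * y) ^^ d) c"

definition eval_term :: "nat \<Rightarrow> 'a::times \<Rightarrow> (nat \<Rightarrow>\<^sub>0 nat) \<Rightarrow> (nat \<Rightarrow> 'a) \<Rightarrow> 'a" where
  "eval_term n c m x = foldl (\<lambda>z i. times_power z (x i) (Poly_Mapping.lookup m i)) c [1..<Suc n]"

definition eval_mpoly :: "nat \<Rightarrow> 'a::Rings.ring mpoly \<Rightarrow> (nat \<Rightarrow> 'a) \<Rightarrow> 'a" where
  "eval_mpoly n f x = (\<Sum>m\<in>Poly_Mapping.keys f. eval_term n (Poly_Mapping.lookup f m) m x)"

definition zero_locus :: "nat \<Rightarrow> nat \<Rightarrow> (nat \<Rightarrow> 'a::Rings.ring mpoly) \<Rightarrow> (nat \<Rightarrow> 'a) set" where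
  "zero_locus n r f = {x \<in> {1..n} \<rightarrow>\<^sub>E UNIV. \<forall>j\<in>{1..r}. eval_mpoly n (f j) x = 0}"

definition ord_p :: "nat \<Rightarrow> nat \<Rightarrow> ereal" where
  "ord_p p m = (if m = 0 then \<infinity> else ereal (real (multiplicity p m)))"

definition ceil_quotient :: "real \<Rightarrow> nat \<Rightarrow> ereal" where
  "ceil_quotient a d = (if d = 0 then \<infinity> else ereal (real_of_int \<lceil>a / real d\<rceil>))"

end

theory Submission
  imports Defs "HOL-Number_Theory.Cong" "HOL-Algebra.Multiplicative_Group"
begin

text \<open>
  In coordinates with respect to a basis of \<open>(R, +)\<close> over \<open>\<int>/p\<close>, the set \<open>Z\<close> consists of the points
  of the cube \<open>{0..<p}\<^bsup>nN\<^esup>\<close> at which \<open>rN\<close> functions \<open>F\<^sub>j\<^sub>l\<close>, of degree at most \<open>deg f\<^sub>j\<close>, are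
  divisible by \<open>p\<close>, so the theorem of Ax and Katz over the prime field suffices. For that, expand the
  indicator of \<open>p dvd x\<close> as a Newton series \<open>\<Sum>k. c\<^sub>k (x choose k)\<close>. By Fleck's congruence
  \<open>p ^ ((k - 1) div (p - 1))\<close> divides \<open>c\<^sub>k\<close>. The number of zeros becomes a sum of products of the
  \<open>c\<^sub>k\<close> with sums over the cube of integer-valued polynomials \<open>\<Prod>j. (F\<^sub>j choose k\<^sub>j)\<close>, and a cube sum of
  a function of low degree is divisible by a high power of \<open>p\<close>. A large \<open>k\<^sub>j\<close> raises the degree, but
  the divisibility of the \<open>c\<^sub>k\<close> compensates for it.
\<close>

section \<open>Newton expansions and Fleck's congruence\<close>

definition forward_diff :: "(nat \<Rightarrow> int) \<Rightarrow> nat \<Rightarrow> int" where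
  "forward_diff h x = h (Suc x) - h x"

lemma forward_diff_pow_add:
  "(forward_diff ^^ k) (\<lambda>x. g x + h x) x = (forward_diff ^^ k) g x + (forward_diff ^^ k) h x"
proof (induction k arbitrary: g h)
  case (Suc k)
  have "forward_diff (\<lambda>x. g x + h x) = (\<lambda>x. forward_diff g x + forward_diff h x)"
    by (auto simp: forward_diff_def)
  then show ?case
    using Suc by (simp add: funpow_Suc_right del: funpow.simps)
qed simp

text \<open>The shift operator is \<open>1 + forward_diff\<close>, so this is the binomial expansion
  of its \<open>n\<close>-th power.\<close>

lemma newton_forward:
  "h (x + n) = (\<Sum>i\<le>n. int (n choose i) * (forward_diff ^^ i) h x)"
proof (induction n arbitrary: h)
  case (Suc n)
  have shift: "(\<lambda>x. h (Suc x)) = (\<lambda>x. h x + forward_diff h x)"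
    by (auto simp: forward_diff_def)
  have "h (x + Suc n) = (\<lambda>x. h (Suc x)) (x + n)"
    by simp
  also have "\<dots> = (\<Sum>i\<le>n. int (n choose i) * (forward_diff ^^ i) (\<lambda>x. h (Suc x)) x)"
    by (rule Suc)
  also have "\<dots> = (\<Sum>i\<le>n. int (n choose i) * (forward_diff ^^ i) h x) +
      (\<Sum>i\<le>n. int (n choose i) * (forward_diff ^^ Suc i) h x)"
    unfolding shift forward_diff_pow_add
    by (simp add: funpow_Suc_right sum.distrib distrib_left del: funpow.simps)
  \<comment> \<open>Splitting off \<open>i = 0\<close> aligns the two sums for Pascal's rule; the
    added top term has the coefficient \<open>n choose Suc n = 0\<close>.\<close>
  also have "(\<Sum>i\<le>n. int (n choose i) * (forward_diff ^^ i) h x) =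
      h x + (\<Sum>i\<le>n. int (n choose Suc i) * (forward_diff ^^ Suc i) h x)"
  proof -
    have "(\<Sum>i\<le>n. int (n choose i) * (forward_diff ^^ i) h x) =
      (\<Sum>i\<le>Suc n. int (n choose i) * (forward_diff ^^ i) h x)"
      by (simp add: binomial_eq_0)
    then show ?thesis
      by (simp add: sum.atMost_Suc_shift del: funpow.simps sum.atMost_Suc)
  qed
  finally show ?case
    by (simp add: sum.atMost_Suc_shift sum.distrib distrib_right del: funpow.simps sum.atMost_Suc)
qed simp

text \<open>As \<open>x choose k = 0\<close> for \<open>k > x\<close>, the sum may end at any
  \<open>K\<close> above \<open>x\<close>; one \<open>K\<close> thus serves many values of
  \<open>x\<close> at once.\<close>

lemma newton_expansion:
  assumes "x \<le> K"
  shows "h x = (\<Sum>k\<le>K. (forward_diff ^^ k) h 0 * int (x choose k))"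
proof -
  have "h x = (\<Sum>i\<le>x. int (x choose i) * (forward_diff ^^ i) h 0)"
    using newton_forward[of h 0 x] by simp
  also have "\<dots> = (\<Sum>k\<le>K. (forward_diff ^^ k) h 0 * int (x choose k))"
    using assms by (intro sum.mono_neutral_cong_left) (auto simp: binomial_eq_0)
  finally show ?thesis .
qed

text \<open>For a \<open>p\<close>-periodic \<open>g\<close>, expanding
  \<open>g (x + p) = g x\<close> expresses the \<open>p\<close>-th difference through those of
  orders 1 to \<open>p - 1\<close>, with coefficients divisible by \<open>p\<close>. So each factor
  \<open>p\<close> costs \<open>p - 1\<close> orders of differencing.\<close>

lemma fleck_congruence:
  assumes p: "Factorial_Ring.prime p" and periodic: "\<And>x. h (x + p) = h x"
    and "1 + s * (p - 1) \<le> k"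
  shows "int p ^ s dvd (forward_diff ^^ k) h x"
  using assms(3)
proof (induction s arbitrary: k)
  case (Suc s)
  have "p \<ge> 2"
    using p by (rule prime_ge_2_nat)
  then have "p + s * (p - 1) \<le> k"
    using Suc.prems by simp
  \<comment> \<open>\<open>p\<close> differences feed the recursion. The other \<open>k'\<close>
    suffice for the induction hypothesis at order \<open>i + k'\<close>, because
    \<open>i \<ge> 1\<close>.\<close>
  then obtain k' where k: "k = p + k'" and k': "s * (p - 1) \<le> k'"
    using nat_le_iff_add by (metis add.assoc le_add1)
  define g where "g = (forward_diff ^^ k') h"
  have "g (x + p) = g x" for x
    unfolding g_def
    by (induction k' arbitrary: x)
       (auto simp: forward_diff_def periodic simp flip: add_Suc)
  then have "g x = (\<Sum>i\<le>p. int (p choose i) * (forward_diff ^^ i) g x)"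
    using newton_forward[of g x p] by simp
  also have "{..p} = insert 0 (insert p {1..<p})"
    using \<open>p \<ge> 2\<close> by auto
  finally have "(forward_diff ^^ p) g x = - (\<Sum>i\<in>{1..<p}. int (p choose i) * (forward_diff ^^ i) g x)"
    using \<open>p \<ge> 2\<close> by simp
  moreover have "int p ^ Suc s dvd int (p choose i) * (forward_diff ^^ i) g x" if "i \<in> {1..<p}" for i
  proof -
    have "p dvd p choose i"
      using that p by (intro dvd_choose_prime) auto
    moreover have "int p ^ s dvd (forward_diff ^^ (i + k')) h x"
      using that k' by (intro Suc.IH) auto
    ultimately show ?thesis
      by (simp add: g_def funpow_add mult_dvd_mono)
  qed
  ultimately show ?case
    unfolding k funpow_add o_def g_def[symmetric] by (auto intro!: dvd_sum)
qed simp

section \<open>Functions of bounded difference degree\<close>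

text \<open>
  All iterated differences are required to be natural numbers, so that the Vandermonde identity
  for natural binomial coefficients suffices in \<open>diff_deg_less_choose\<close>.
\<close>

primrec diff_deg_less :: "'i set \<Rightarrow> nat \<Rightarrow> (('i \<Rightarrow> nat) \<Rightarrow> nat) \<Rightarrow> bool" where
  "diff_deg_less I 0 g \<longleftrightarrow> (\<forall>y. g y = 0)"
| "diff_deg_less I (Suc D) g \<longleftrightarrow>
    (\<forall>i\<in>I. \<exists>h. diff_deg_less I D h \<and> (\<forall>y. g (y(i := Suc (y i))) = g y + h y))"

lemma diff_deg_less_const_zero: "diff_deg_less I D (\<lambda>_. 0)"
  by (induction D) auto

lemma diff_deg_less_const: "diff_deg_less I (Suc D) (\<lambda>_. c)"
  by (auto intro!: exI[of _ "\<lambda>_. 0"] diff_deg_less_const_zero)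

lemma diff_deg_less_coordinate: "diff_deg_less I (Suc (Suc D)) (\<lambda>y. y i)"
  unfolding diff_deg_less.simps(2)[of I "Suc D"]
  by (auto intro!: exI[of _ "\<lambda>_. if i = _ then 1 else 0"] diff_deg_less_const
      simp del: diff_deg_less.simps)

lemma diff_deg_less_Suc: "diff_deg_less I D g \<Longrightarrow> diff_deg_less I (Suc D) g"
proof (induction D arbitrary: g)
  case (Suc D)
  then show ?case
    by (subst diff_deg_less.simps)
       (fastforce simp del: diff_deg_less.simps(2) simp: diff_deg_less.simps(2)[of I D g])
qed (auto intro!: exI[of _ "\<lambda>_. 0"])

lemma diff_deg_less_mono: "D \<le> E \<Longrightarrow> diff_deg_less I D g \<Longrightarrow> diff_deg_less I E g"
  by (induction E rule: dec_induct) (auto simp del: diff_deg_less.simps intro: diff_deg_less_Suc)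

lemma diff_deg_less_subset: "diff_deg_less I D g \<Longrightarrow> J \<subseteq> I \<Longrightarrow> diff_deg_less J D g"
proof (induction D arbitrary: g)
  case (Suc D)
  then show ?case
    by simp (meson subsetD)
qed simp

lemma diff_deg_less_add:
  "diff_deg_less I D g \<Longrightarrow> diff_deg_less I D h \<Longrightarrow> diff_deg_less I D (\<lambda>y. g y + h y)"
proof (induction D arbitrary: g h)
  case (Suc D)
  show ?case
    unfolding diff_deg_less.simps
  proof
    fix i assume "i \<in> I"
    then obtain g' h' where "diff_deg_less I D g'" "\<And>y. g (y(i := Suc (y i))) = g y + g' y"
      "diff_deg_less I D h'" "\<And>y. h (y(i := Suc (y i))) = h y + h' y"
      using Suc.prems by fastforce
    then show "\<exists>f. diff_deg_less I D f \<and>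
      (\<forall>y. g (y(i := Suc (y i))) + h (y(i := Suc (y i))) = g y + h y + f y)"
      by (intro exI[of _ "\<lambda>y. g' y + h' y"]) (auto intro: Suc.IH)
  qed
qed simp

lemma diff_deg_less_sum:
  "(\<And>a. a \<in> A \<Longrightarrow> diff_deg_less I D (g a)) \<Longrightarrow> diff_deg_less I D (\<lambda>y. \<Sum>a\<in>A. g a y)"
  by (induction A rule: infinite_finite_induct)
     (auto simp: diff_deg_less_const_zero intro: diff_deg_less_add simp del: diff_deg_less.simps)

text \<open>Discrete Leibniz rule: the difference of \<open>g * h\<close> is
  \<open>g' * h + g * h' + g' * h'\<close>. In each summand the degrees add up to less, hence the
  induction on \<open>a + b\<close>.\<close>

lemma diff_deg_less_mult:
  "diff_deg_less I (Suc a) g \<Longrightarrow> diff_deg_less I (Suc b) h \<Longrightarrow>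
    diff_deg_less I (Suc (a + b)) (\<lambda>y. g y * h y)"
proof (induction "a + b" arbitrary: a b g h rule: less_induct)
  case less
  show ?case
    unfolding diff_deg_less.simps
  proof
    fix i assume i: "i \<in> I"
    obtain g' where g': "diff_deg_less I a g'" "\<And>y. g (y(i := Suc (y i))) = g y + g' y"
      using less.prems i by fastforce
    obtain h' where h': "diff_deg_less I b h'" "\<And>y. h (y(i := Suc (y i))) = h y + h' y"
      using less.prems i by fastforce
    \<comment> \<open>Stated for every \<open>k\<close>, because it serves both
      \<open>g' * h\<close> and \<open>g' * h'\<close>; for \<open>a = 0\<close> the factor
      \<open>g'\<close> vanishes.\<close>
    have left: "diff_deg_less I (a + b) (\<lambda>y. g' y * k y)" if "diff_deg_less I (Suc b) k" for k
    proof (cases a)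
      case 0
      then show ?thesis using g' by (simp add: diff_deg_less_const_zero)
    next
      case (Suc a')
      then show ?thesis
        using less.hyps[of a' b g' k] g' that by simp
    qed
    have right: "diff_deg_less I (a + b) (\<lambda>y. g y * h' y)"
    proof (cases b)
      case 0
      then show ?thesis using h' by (simp add: diff_deg_less_const_zero)
    next
      case (Suc b')
      then show ?thesis
        using less.hyps[of a b' g h'] h' less.prems by simp
    qed
    show "\<exists>f. diff_deg_less I (a + b) f \<and>
      (\<forall>y. g (y(i := Suc (y i))) * h (y(i := Suc (y i))) = g y * h y + f y)"
      using left[OF less.prems(2)] right left[OF diff_deg_less_Suc[OF h'(1)]]
      by (intro exI[of _ "\<lambda>y. g' y * h y + g y * h' y + g' y * h' y"])
         (auto intro!: diff_deg_less_add simp: g' h' algebra_simps)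
  qed
qed

lemma diff_deg_less_prod:
  assumes "finite J" "\<And>j. j \<in> J \<Longrightarrow> diff_deg_less I (Suc (d j)) (g j)"
  shows "diff_deg_less I (Suc (\<Sum>j\<in>J. d j)) (\<lambda>y. \<Prod>j\<in>J. g j y)"
  using assms
  by (induction J rule: finite_induct)
     (auto simp: diff_deg_less_const intro: diff_deg_less_mult simp del: diff_deg_less.simps)

text \<open>With \<open>G\<close> the difference of \<open>F\<close>, Vandermonde turns the
  difference of \<open>F choose k\<close> into the sum of
  \<open>(G choose t) * (F choose (k - t))\<close> over \<open>t \<ge> 1\<close>. The outer
  induction on the degree handles the first factor, the inner one on \<open>k\<close> the
  second.\<close>

lemma diff_deg_less_choose:
  "diff_deg_less I (Suc d) F \<Longrightarrow> diff_deg_less I (Suc (k * d)) (\<lambda>y. F y choose k)"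
proof (induction d arbitrary: F k)
  case 0
  then show ?case
    by (auto intro!: exI[of _ "\<lambda>_. 0"])
next
  case outer: (Suc d)
  show ?case
  proof (induction k rule: less_induct)
    case (less k)
    show ?case
      unfolding diff_deg_less.simps(2)[of I "k * Suc d"]
    proof
      fix i assume "i \<in> I"
      then obtain G where G: "diff_deg_less I (Suc d) G" "\<And>y. F (y(i := Suc (y i))) = F y + G y"
        using outer.prems unfolding diff_deg_less.simps(2)[of I "Suc d"] by blast
      have "(F y + G y) choose k =
          (F y choose k) + (\<Sum>t\<in>{1..k}. (G y choose t) * (F y choose (k - t)))" for y
      proof -
        have "(F y + G y) choose k = (\<Sum>t\<le>k. (G y choose t) * (F y choose (k - t)))"
          by (simp add: vandermonde add.commute)
        also have "{..k} = insert 0 {1..k}"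
          by auto
        finally show ?thesis
          by simp
      qed
      moreover have "diff_deg_less I (k * Suc d) (\<lambda>y. \<Sum>t\<in>{1..k}. (G y choose t) * (F y choose (k - t)))"
      proof (rule diff_deg_less_sum)
        fix t assume t: "t \<in> {1..k}"
        have "diff_deg_less I (Suc (t * d + (k - t) * Suc d)) (\<lambda>y. (G y choose t) * (F y choose (k - t)))"
          using t by (intro diff_deg_less_mult outer.IH G less.IH) auto
        \<comment> \<open>The degree is \<open>k * Suc d - t\<close>, and \<open>t \<ge> 1\<close>
          makes the bound strict.\<close>
        moreover have "Suc (t * d + (k - t) * Suc d) \<le> k * Suc d"
        proof -
          obtain u where "k = t + u" using t by (auto simp: le_iff_add)
          then show ?thesis using t by (simp add: algebra_simps)
        qed
        ultimately show "diff_deg_less I (k * Suc d) (\<lambda>y. (G y choose t) * (F y choose (k - t)))"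
          by (rule diff_deg_less_mono[rotated])
      qed
      ultimately show "\<exists>h. diff_deg_less I (k * Suc d) h \<and>
          (\<forall>y. F (y(i := Suc (y i))) choose k = (F y choose k) + h y)"
        unfolding G(2) by blast
    qed
  qed
qed

text \<open>Fixing coordinate \<open>i\<close> commutes with a shift in any other
  coordinate.\<close>

lemma diff_deg_less_fix_coordinate:
  "diff_deg_less I D g \<Longrightarrow> i \<notin> I \<Longrightarrow> diff_deg_less I D (\<lambda>y. g (y(i := c)))"
proof (induction D arbitrary: g)
  case (Suc D)
  show ?case
    unfolding diff_deg_less.simps
  proof
    fix j assume j: "j \<in> I"
    then obtain h where h: "diff_deg_less I D h" "\<And>y. g (y(j := Suc (y j))) = g y + h y"
      using Suc.prems by fastforce
    have "i \<noteq> j"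
      using j Suc.prems by blast
    then have "g (y(j := Suc (y j), i := c)) = g (y(i := c)) + h (y(i := c))" for y
      using h(2)[of "y(i := c)"] by (simp add: fun_upd_twist)
    then show "\<exists>h. diff_deg_less I D h \<and>
        (\<forall>y. g (y(j := Suc (y j), i := c)) = g (y(i := c)) + h y)"
      using Suc.IH[OF h(1) Suc.prems(2)] by blast
  qed
qed simp

text \<open>\<open>h e\<close> is the \<open>e\<close>-th difference of \<open>g\<close> in
  direction \<open>i\<close>; hence the degree \<open>D - e\<close> and the end of the series at
  \<open>D\<close>. Pascal's rule gives the step in \<open>c\<close>.\<close>

lemma diff_deg_less_newton:
  assumes "diff_deg_less I D g" "i \<in> I"
  obtains h where "\<And>e. diff_deg_less I (D - e) (h e)"
    "\<And>y c. g (y(i := c)) = (\<Sum>e<D. (c choose e) * h e (y(i := 0)))"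
  using assms
proof (induction D arbitrary: g thesis)
  case 0
  show ?case
    by (rule 0(1)[of "\<lambda>_ _. 0"]) (use 0 in auto)
next
  case (Suc D)
  obtain G where G: "diff_deg_less I D G" "\<And>y. g (y(i := Suc (y i))) = g y + G y"
    using Suc.prems by fastforce
  obtain h where h: "\<And>e. diff_deg_less I (D - e) (h e)"
    "\<And>y c. G (y(i := c)) = (\<Sum>e<D. (c choose e) * h e (y(i := 0)))"
    using Suc.IH[OF _ G(1) assms(2)] by blast
  define h' where "h' = (\<lambda>e. case e of 0 \<Rightarrow> g | Suc e \<Rightarrow> h e)"
  show ?case
  proof (rule Suc.prems(1)[of h'])
    show "diff_deg_less I (Suc D - e) (h' e)" for e
      using h(1) Suc.prems(2) by (cases e) (simp_all add: h'_def del: diff_deg_less.simps)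
    show "g (y(i := c)) = (\<Sum>e<Suc D. (c choose e) * h' e (y(i := 0)))" for y c
    proof (induction c)
      case 0
      show ?case
        by (simp add: sum.lessThan_Suc_shift h'_def del: sum.lessThan_Suc)
    next
      case (Suc c)
      show ?case
        using G(2)[of "y(i := c)", unfolded fun_upd_same fun_upd_upd] Suc h(2)[of y c]
        by (simp add: sum.lessThan_Suc_shift h'_def sum.distrib algebra_simps
            del: sum.lessThan_Suc fun_upd_apply)
    qed
  qed
qed

section \<open>Sums over a cube\<close>

lemma sum_PiE_insert:
  assumes "i \<notin> I"
  shows "(\<Sum>y\<in>PiE (insert i I) (\<lambda>_. C). g y) = (\<Sum>y\<in>PiE I (\<lambda>_. C). \<Sum>c\<in>C. g (y(i := c)))"
  unfolding PiE_insert_eq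
  by (subst sum.reindex[OF inj_combinator[OF assms]], subst sum.swap)
     (simp add: sum.cartesian_product split_def)

text \<open>
  Summing a Newton expansion over one coordinate turns the binomial coefficient at \<open>e\<close> into
  \<open>p choose Suc e\<close>: this is divisible by \<open>p\<close> unless \<open>e = p - 1\<close>, and then the degree has dropped
  by \<open>p - 1\<close>.
\<close>

lemma cube_sum_dvd:
  assumes p: "Factorial_Ring.prime p" and "finite I"
    and "diff_deg_less I D g" and "D + v * (p - 1) \<le> (card I + 1) * (p - 1)"
  shows "p ^ v dvd (\<Sum>y\<in>PiE I (\<lambda>_. {..<p}). g y)"
  using assms(2-)
proof (induction I arbitrary: D g v rule: finite_induct)
  case empty
  have "p - 1 > 0"
    using prime_gt_1_nat[OF p] by simp
  moreover have "v * (p - 1) \<le> 1 * (p - 1)"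
    using empty by (simp add: algebra_simps)
  ultimately have "v \<le> 1"
    by (simp only: mult_le_cancel2)
  \<comment> \<open>The cube is a single point here. The value \<open>v = 1\<close> leaves only
    \<open>D = 0\<close>, where \<open>g\<close> is identically zero.\<close>
  then consider "v = 0" | "v = 1" "D = 0"
    using empty by (cases v) auto
  then show ?case
    using empty by cases auto
next
  case (insert i I)
  have p1: "p > 1"
    using prime_gt_1_nat[OF p] .
  obtain h where h: "\<And>e. diff_deg_less (insert i I) (D - e) (h e)"
    "\<And>y c. g (y(i := c)) = (\<Sum>e<D. (c choose e) * h e (y(i := 0)))"
    using diff_deg_less_newton[OF insert.prems(1), of i] by blast
  have deg: "diff_deg_less I (D - e) (\<lambda>y. h e (y(i := 0)))" for e
    using h(1) insert.hyps by (intro diff_deg_less_fix_coordinate) (auto intro: diff_deg_less_subset)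
  have inner: "(\<Sum>c<p. g (y(i := c))) = (\<Sum>e<D. (p choose Suc e) * h e (y(i := 0)))" for y
  proof -
    have "(\<Sum>c<p. g (y(i := c))) = (\<Sum>e<D. (\<Sum>c<p. c choose e) * h e (y(i := 0)))"
      unfolding h(2) sum_distrib_right by (rule sum.swap)
    moreover have "(\<Sum>c<p. c choose e) = p choose Suc e" for e
      using sum_choose_upper[of e "p - 1"] p1 by (simp add: lessThan_Suc_atMost[symmetric])
    ultimately show ?thesis by simp
  qed
  have "(\<Sum>y\<in>PiE (insert i I) (\<lambda>_. {..<p}). g y) =
      (\<Sum>e<D. (p choose Suc e) * (\<Sum>y\<in>PiE I (\<lambda>_. {..<p}). h e (y(i := 0))))"
    unfolding sum_PiE_insert[OF insert.hyps(2)] inner sum_distrib_left by (rule sum.swap)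
  also have "p ^ v dvd \<dots>"
  proof (rule dvd_sum)
    fix e assume "e \<in> {..<D}"
    then have "e < D" by simp
    \<comment> \<open>Dropping \<open>i\<close> lowers the admissible bound by \<open>p - 1\<close>.
      Either a factor \<open>p\<close> of the binomial coefficient reduces the demand from
      \<open>v\<close> to \<open>v - 1\<close>, or \<open>e = p - 1\<close> lowers the degree
      enough, or the coefficient is 0.\<close>
    have bound: "D + v * (p - 1) \<le> (card I + 1) * (p - 1) + (p - 1)"
      using insert by simp
    consider "Suc e < p" | "Suc e = p" | "Suc e > p"
      by linarith
    then show "p ^ v dvd (p choose Suc e) * (\<Sum>y\<in>PiE I (\<lambda>_. {..<p}). h e (y(i := 0)))"
    proof cases
      case 1
      show ?thesis
      proof (cases v)
        case (Suc w)
        have "p dvd p choose Suc e"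
          using 1 p by (intro dvd_choose_prime) auto
        moreover have "p ^ w dvd (\<Sum>y\<in>PiE I (\<lambda>_. {..<p}). h e (y(i := 0)))"
          using bound Suc by (intro insert.IH[OF deg]) simp
        ultimately show ?thesis
          by (simp add: Suc mult_dvd_mono)
      qed simp
    next
      case 2
      then have "p ^ v dvd (\<Sum>y\<in>PiE I (\<lambda>_. {..<p}). h e (y(i := 0)))"
        using bound \<open>e < D\<close> by (intro insert.IH[OF deg]) auto
      then show ?thesis
        by simp
    qed (simp add: binomial_eq_0)
  qed
  finally show ?case .
qed

section \<open>The theorem of Ax and Katz over the prime field\<close>

text \<open>Given \<open>0 < D\<close>, \<open>bound\<close> says that \<mu> is at most the ceiling
  of \<open>(card I - (\<Sum>j\<in>J. d j)) / D\<close>, in a form free of division and of truncated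
  subtraction.\<close>

lemma ax_katz_prime_field:
  fixes F :: "'j \<Rightarrow> ('i \<Rightarrow> nat) \<Rightarrow> nat"
  assumes p: "Factorial_Ring.prime p" and I: "finite I" and J: "finite J"
    and F: "\<And>j. j \<in> J \<Longrightarrow> diff_deg_less I (Suc (d j)) (F j)"
    and d: "\<And>j. j \<in> J \<Longrightarrow> d j \<le> D" and "0 < D"
    and bound: "D * \<mu> + (\<Sum>j\<in>J. d j) < card I + D"
  shows "p ^ \<mu> dvd card {y \<in> PiE I (\<lambda>_. {..<p}). \<forall>j\<in>J. p dvd F j y}"
proof -
  have p1: "p - 1 > 0"
    using prime_gt_1_nat[OF p] by simp
  let ?Y = "PiE I (\<lambda>_. {..<p})"
  define \<delta> :: "nat \<Rightarrow> int" where "\<delta> x = (if p dvd x then 1 else 0)" for x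
  define c where "c k = (forward_diff ^^ k) \<delta> 0" for k
  \<comment> \<open>A common bound for the values on the cube, so that all Newton series end at the
    same index; the inserted 0 covers an empty set of values.\<close>
  define K where "K = Max (insert 0 ((\<lambda>(j, y). F j y) ` (J \<times> ?Y)))"
  have finY: "finite ?Y"
    using I by (intro finite_PiE) auto
  have K: "F j y \<le> K" if "j \<in> J" "y \<in> ?Y" for j y
    unfolding K_def by (rule Max_ge) (use finY J that in force)+
  have "int (card {y \<in> ?Y. \<forall>j\<in>J. p dvd F j y}) = (\<Sum>y\<in>?Y. if \<forall>j\<in>J. p dvd F j y then 1 else 0)"
    using finY by (simp add: sum.If_cases Int_def)
  also have "\<dots> = (\<Sum>y\<in>?Y. \<Prod>j\<in>J. \<delta> (F j y))"
    using J by (intro sum.cong) (auto simp: \<delta>_def intro!: prod_zero[symmetric])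
  also have "\<dots> = (\<Sum>y\<in>?Y. \<Prod>j\<in>J. \<Sum>k\<le>K. c k * int (F j y choose k))"
    by (intro sum.cong prod.cong refl) (simp add: c_def newton_expansion[OF K, of _ _ \<delta>])
  also have "\<dots> = (\<Sum>y\<in>?Y. \<Sum>\<kappa>\<in>PiE J (\<lambda>_. {..K}). \<Prod>j\<in>J. c (\<kappa> j) * int (F j y choose \<kappa> j))"
    using J by (simp add: prod_sum_PiE)
  also have "\<dots> = (\<Sum>\<kappa>\<in>PiE J (\<lambda>_. {..K}). (\<Prod>j\<in>J. c (\<kappa> j)) *
      int (\<Sum>y\<in>?Y. \<Prod>j\<in>J. (F j y choose \<kappa> j)))"
    by (subst sum.swap) (simp add: prod.distrib sum_distrib_left)
  also have "int p ^ \<mu> dvd \<dots>"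
  proof (rule dvd_sum)
    fix \<kappa> :: "'j \<Rightarrow> nat"
    \<comment> \<open>The exponent from Fleck's congruence. Truncated subtraction makes it 0 for
      \<open>\<kappa> j = 0\<close>, where no divisibility is available.\<close>
    define s where "s j = (\<kappa> j - 1) div (p - 1)" for j
    define S where "S = (\<Sum>j\<in>J. s j)"
    have \<kappa>: "\<kappa> j \<le> (p - 1) * (s j + 1)" for j
    proof -
      have "\<kappa> j - 1 = (p - 1) * s j + (\<kappa> j - 1) mod (p - 1)"
        by (simp add: s_def)
      moreover have "(\<kappa> j - 1) mod (p - 1) < p - 1"
        using p1 by simp
      ultimately show ?thesis
        unfolding distrib_left by linarith
    qed
    have c: "int p ^ s j dvd c (\<kappa> j)" for j
    proof (cases "\<kappa> j = 0")
      case False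
      have "s j * (p - 1) \<le> \<kappa> j - 1"
        by (simp add: s_def div_times_less_eq_dividend)
      then have "1 + s j * (p - 1) \<le> \<kappa> j"
        using False by simp
      then show ?thesis
        unfolding c_def by (intro fleck_congruence[OF p]) (simp_all add: \<delta>_def)
    qed (simp add: s_def)
    have cS: "int p ^ S dvd (\<Prod>j\<in>J. c (\<kappa> j))"
      unfolding S_def power_sum using c by (intro prod_dvd_prod) auto
    show "int p ^ \<mu> dvd (\<Prod>j\<in>J. c (\<kappa> j)) * int (\<Sum>y\<in>?Y. \<Prod>j\<in>J. (F j y choose \<kappa> j))"
    \<comment> \<open>If the Newton coefficients do not supply all of \<open>p ^ \<mu>\<close>, the
      cube sum has to supply the missing \<open>Suc u\<close> factors.\<close>
    proof (cases "\<mu> \<le> S")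
      case True
      then show ?thesis
        using cS by (meson dvd_mult2 dvd_trans le_imp_power_dvd)
    next
      case False
      then obtain u where u: "\<mu> = S + Suc u"
        by (metis add_Suc_right less_iff_Suc_add not_le)
      have "diff_deg_less I (Suc (\<Sum>j\<in>J. \<kappa> j * d j)) (\<lambda>y. \<Prod>j\<in>J. (F j y choose \<kappa> j))"
        using F J by (intro diff_deg_less_prod diff_deg_less_choose) auto
      moreover have "Suc (\<Sum>j\<in>J. \<kappa> j * d j) + Suc u * (p - 1) \<le> (card I + 1) * (p - 1)"
      proof -
        \<comment> \<open>A factor \<open>p\<close> from Fleck's congruence is paid for by at most
          \<open>D * (p - 1)\<close> in the degree, matching the term \<open>D * \<mu>\<close> of
          \<open>bound\<close>.\<close>
        have "(\<Sum>j\<in>J. \<kappa> j * d j) \<le> (\<Sum>j\<in>J. (p - 1) * (d j + D * s j))"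
        proof (rule sum_mono)
          fix j assume "j \<in> J"
          have "\<kappa> j * d j \<le> (p - 1) * (s j + 1) * d j"
            using \<kappa> by (rule mult_right_mono) simp
          also have "\<dots> = (p - 1) * (d j + d j * s j)"
            by (simp only: distrib_left distrib_right mult_1_right mult_1_left ac_simps)
          also have "\<dots> \<le> (p - 1) * (d j + D * s j)"
            using d[OF \<open>j \<in> J\<close>] by (intro mult_left_mono add_left_mono mult_right_mono) auto
          finally show "\<kappa> j * d j \<le> (p - 1) * (d j + D * s j)" .
        qed
        also have "\<dots> = (p - 1) * ((\<Sum>j\<in>J. d j) + D * S)"
          by (simp only: S_def sum_distrib_left[symmetric] sum.distrib)
        \<comment> \<open>The \<open>Suc\<close> of the strict degree bound is absorbed by
          \<open>1 \<le> p - 1\<close>.\<close>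
        finally have "Suc (\<Sum>j\<in>J. \<kappa> j * d j) + Suc u * (p - 1) \<le>
            (p - 1) * ((\<Sum>j\<in>J. d j) + D * S + Suc u) + (p - 1)"
          using p1 unfolding distrib_left by (simp add: mult.commute)
        also have "\<dots> = (p - 1) * ((\<Sum>j\<in>J. d j) + D * S + Suc u + 1)"
          by (simp only: distrib_left mult_1_right)
        also have "\<dots> \<le> (p - 1) * (card I + 1)"
        proof (rule mult_left_mono)
          \<comment> \<open>The summand \<open>D\<close> in \<open>bound\<close> cancels against one
            \<open>D\<close> of \<open>D * (S + Suc u)\<close>; what remains is
            \<open>D * u\<close>, which dominates \<open>u\<close>.\<close>
          have "u \<le> D * u"
            using \<open>0 < D\<close> by simp
          then show "(\<Sum>j\<in>J. d j) + D * S + Suc u + 1 \<le> card I + 1"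
            using bound unfolding u distrib_left mult_Suc_right by linarith
        qed simp
        finally show ?thesis
          by (simp add: mult.commute)
      qed
      ultimately have "p ^ Suc u dvd (\<Sum>y\<in>?Y. \<Prod>j\<in>J. (F j y choose \<kappa> j))"
        by (rule cube_sum_dvd[OF p I])
      then have "int p ^ Suc u dvd int (\<Sum>y\<in>?Y. \<Prod>j\<in>J. (F j y choose \<kappa> j))"
        by (simp only: int_dvd_int_iff[symmetric] of_nat_power)
      then show ?thesis
        unfolding u power_add using cS by (rule mult_dvd_mono[rotated])
    qed
  qed
  finally show ?thesis
    by (simp only: int_dvd_int_iff[symmetric] of_nat_power)
qed

section \<open>Coordinates in an elementary abelian group\<close>

text \<open>A substitute for multiplication by \<open>of_nat k\<close>, which would require a
  unit.\<close>

definition nscale :: "nat \<Rightarrow> 'a::comm_monoid_add \<Rightarrow> 'a" where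
  "nscale k a = (\<Sum>_<k. a)"

lemma nscale_0 [simp]: "nscale 0 a = 0"
  and nscale_Suc [simp]: "nscale (Suc k) a = nscale k a + a"
  and nscale_zero [simp]: "nscale k 0 = 0"
  by (simp_all add: nscale_def)

lemma nscale_add_left: "nscale (j + k) a = nscale j a + nscale k a"
  by (induction k) (simp_all add: add.assoc)

lemma nscale_mult_left: "nscale (j * k) a = nscale j (nscale k a)"
  by (induction j) (simp_all add: nscale_add_left add.commute)

lemma nscale_sum: "nscale k (\<Sum>x\<in>A. g x) = (\<Sum>x\<in>A. nscale k (g x))"
  unfolding nscale_def by (rule sum.swap)

lemma nscale_sum_left: "nscale (\<Sum>x\<in>A. k x) a = (\<Sum>x\<in>A. nscale (k x) a)"
  by (induction A rule: infinite_finite_induct) (simp_all add: nscale_add_left)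

lemma nscale_mult_nscale:
  fixes a b :: "'a::Rings.ring"
  shows "nscale j a * nscale k b = nscale (j * k) (a * b)"
proof -
  have "nscale j a * c = nscale j (a * c)" "c * nscale k b = nscale k (c * b)" for c
    by (simp_all add: nscale_def sum_distrib_left sum_distrib_right)
  then show ?thesis
    by (metis nscale_mult_left mult.commute)
qed

lemma nscale_mod:
  assumes "nscale p a = 0"
  shows "nscale (k mod p) a = nscale k a"
proof -
  have "nscale k a = nscale (k div p * p + k mod p) a"
    by simp
  also have "\<dots> = nscale (k mod p) a"
    by (simp only: nscale_add_left nscale_mult_left assms nscale_zero add_0_left)
  finally show ?thesis ..
qed

text \<open>The coefficients are natural numbers and not residues, so functions satisfying
  \<open>diff_deg_less\<close> can be inserted directly.\<close>

definition lincomb :: "nat \<Rightarrow> (nat \<Rightarrow> 'a::comm_monoid_add) \<Rightarrow> (nat \<Rightarrow> nat) \<Rightarrow> 'a" where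
  "lincomb N e c = (\<Sum>l=1..N. nscale (c l) (e l))"

lemma lincomb_cong:
  "(\<And>l. l \<in> {1..N} \<Longrightarrow> c l = c' l) \<Longrightarrow> lincomb N e c = lincomb N e c'"
  unfolding lincomb_def by (intro sum.cong) auto

lemma lincomb_restrict: "lincomb N e (restrict c {1..N}) = lincomb N e c"
  by (rule lincomb_cong) simp

lemma lincomb_add: "lincomb N e (\<lambda>l. c l + c' l) = lincomb N e c + lincomb N e c'"
  by (simp add: lincomb_def nscale_add_left sum.distrib)

lemma lincomb_mult: "lincomb N e (\<lambda>l. k * c l) = nscale k (lincomb N e c)"
  by (simp add: lincomb_def nscale_mult_left nscale_sum)

lemma lincomb_sum: "lincomb N e (\<lambda>l. \<Sum>x\<in>A. c x l) = (\<Sum>x\<in>A. lincomb N e (c x))"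
  unfolding lincomb_def nscale_sum_left by (rule sum.swap)

lemma lincomb_mod:
  fixes e :: "nat \<Rightarrow> 'a::comm_monoid_add"
  assumes "\<And>a::'a. nscale p a = 0"
  shows "lincomb N e (\<lambda>l. c l mod p) = lincomb N e c"
  by (simp add: lincomb_def nscale_mod assms)

definition is_basis :: "nat \<Rightarrow> nat \<Rightarrow> (nat \<Rightarrow> 'a::comm_monoid_add) \<Rightarrow> bool" where
  "is_basis p N e \<longleftrightarrow> bij_betw (lincomb N e) ({1..N} \<rightarrow>\<^sub>E {..<p}) UNIV"

text \<open>If two equal combinations had different last coefficients, the difference of these would
  be invertible modulo \<open>p\<close>, and \<open>a\<close> would lie in the span of the old
  family.\<close>

lemma lincomb_independent_extend:
  fixes e :: "nat \<Rightarrow> 'a::ab_group_add"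
  assumes p: "Factorial_Ring.prime p" and exp: "\<And>a::'a. nscale p a = 0"
    and inj: "inj_on (lincomb N e) ({1..N} \<rightarrow>\<^sub>E {..<p})" and a: "a \<notin> range (lincomb N e)"
  shows "inj_on (lincomb (Suc N) (e(Suc N := a))) ({1..Suc N} \<rightarrow>\<^sub>E {..<p})"
proof (rule inj_onI)
  have lincomb_Suc: "lincomb (Suc N) (e(Suc N := a)) c = lincomb N e c + nscale (c (Suc N)) a" for c
    by (simp add: lincomb_def)
  have last_le: "c (Suc N) \<le> c' (Suc N)"
    if c: "c \<in> {1..Suc N} \<rightarrow>\<^sub>E {..<p}"
      and eq: "lincomb (Suc N) (e(Suc N := a)) c = lincomb (Suc N) (e(Suc N := a)) c'" for c c'
  proof (rule ccontr)
    assume "\<not> ?thesis"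
    then obtain k where k: "c (Suc N) = c' (Suc N) + Suc k"
      by (metis add_Suc_right less_iff_Suc_add not_le)
    have "Suc k < p"
      using c k by (auto dest: PiE_mem[of _ _ _ "Suc N"])
    then have "\<not> p dvd Suc k"
      using dvd_imp_le by fastforce
    then have "coprime (Suc k) p"
      using p prime_imp_coprime_nat coprime_commute by blast
    \<comment> \<open>Multiplication by \<open>k'\<close> isolates \<open>a\<close> in the
      relation.\<close>
    then obtain k' where "[Suc k * k' = 1] (mod p)"
      using cong_solve_coprime_nat by (metis One_nat_def)
    then have k': "nscale (k' * Suc k) a = a"
      using nscale_mod[OF exp[of a], of "k' * Suc k"] nscale_mod[OF exp[of a], of 1]
      by (simp add: cong_def mult.commute del: mult_Suc mult_Suc_right)
    have "lincomb N e c + nscale (Suc k) a = lincomb N e c'"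
      using eq unfolding lincomb_Suc k nscale_add_left by (simp add: algebra_simps)
    \<comment> \<open>Multiplication by \<open>p - 1\<close> is negation, which keeps all
      coefficients natural.\<close>
    moreover have "nscale (p - 1) b + b = 0" for b :: 'a
      using exp[of b] prime_gt_0_nat[OF p] nscale_Suc[of "p - 1" b] by simp
    ultimately have "nscale (Suc k) a = lincomb N e c' + nscale (p - 1) (lincomb N e c)"
      by (metis add.assoc add.commute add.right_neutral)
    then have "a = nscale k' (lincomb N e (\<lambda>l. c' l + (p - 1) * c l))"
      unfolding lincomb_add lincomb_mult using k' by (simp only: nscale_mult_left)
    then show False
      using a unfolding lincomb_mult[symmetric] by blast
  qed
  fix c c'
  assume c: "c \<in> {1..Suc N} \<rightarrow>\<^sub>E {..<p}" and c': "c' \<in> {1..Suc N} \<rightarrow>\<^sub>E {..<p}"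
    and eq: "lincomb (Suc N) (e(Suc N := a)) c = lincomb (Suc N) (e(Suc N := a)) c'"
  have last: "c (Suc N) = c' (Suc N)"
    using last_le[OF c eq] last_le[OF c' eq[symmetric]] by simp
  then have "lincomb N e c = lincomb N e c'"
    using eq by (simp add: lincomb_Suc)
  then have "lincomb N e (restrict c {1..N}) = lincomb N e (restrict c' {1..N})"
    by (simp only: lincomb_restrict)
  then have "restrict c {1..N} = restrict c' {1..N}"
    by (rule inj_onD[OF inj]) (use c c' in auto)
  then have "c l = c' l" if "l \<in> {1..N}" for l
    using that by (metis restrict_apply')
  then show "c = c'"
    using last by (intro PiE_ext[OF c c']) (metis atLeastAtMost_iff le_Suc_eq)
qed

text \<open>An independent family of maximal size spans, as any element outside its span would
  extend it. The size is bounded through \<open>N < p ^ N \<le> card UNIV\<close>.\<close>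

lemma ex_basis:
  assumes p: "Factorial_Ring.prime p" and exp: "\<And>a::'a::{ab_group_add,finite}. nscale p a = 0"
  obtains N and e :: "nat \<Rightarrow> 'a::{ab_group_add,finite}" where "is_basis p N e"
proof -
  let ?B = "\<lambda>N. {1..N} \<rightarrow>\<^sub>E {..<p}"
  let ?P = "\<lambda>N. \<exists>e :: nat \<Rightarrow> 'a. inj_on (lincomb N e) (?B N)"
  have "?P 0"
    by (auto simp: inj_on_def)
  moreover have "N \<le> card (UNIV :: 'a set)" if "?P N" for N
  proof -
    have "p ^ N \<le> card (UNIV :: 'a set)"
      using that card_inj_on_le[of _ "?B N" "UNIV :: 'a set"] by (auto simp: card_funcsetE)
    moreover have "N < p ^ N"
      using prime_gt_1_nat[OF p] by (intro power_gt_expt) simp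
    ultimately show ?thesis by simp
  qed
  ultimately obtain N where N: "?P N" and max: "\<And>M. ?P M \<Longrightarrow> M \<le> N"
    using Greatest_le_nat[of ?P] GreatestI_nat[of ?P] by blast
  then obtain e :: "nat \<Rightarrow> 'a" where e: "inj_on (lincomb N e) (?B N)"
    by blast
  have "a \<in> lincomb N e ` ?B N" for a
  proof -
    have "a \<in> range (lincomb N e)"
      using lincomb_independent_extend[OF p exp e, of a] max[of "Suc N"] by fastforce
    then obtain c where "a = lincomb N e c"
      by blast
    also have "\<dots> = lincomb N e (\<lambda>l\<in>{1..N}. c l mod p)"
      by (simp only: lincomb_restrict lincomb_mod[OF exp])
    finally show ?thesis
      using prime_gt_0_nat[OF p] by (intro image_eqI) auto
  qed
  then have "is_basis p N e"
    using e by (auto simp: is_basis_def bij_betw_def)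
  then show thesis
    by (rule that)
qed

lemma basis_surj:
  assumes "is_basis p N e"
  obtains c where "a = lincomb N e c" "c \<in> {1..N} \<rightarrow>\<^sub>E {..<p}"
  using assms unfolding is_basis_def bij_betw_def by blast

text \<open>Unique coordinates after reduction modulo \<open>p\<close> turn one equation in the rng
  into \<open>N\<close> divisibility conditions.\<close>

lemma basis_lincomb_eq_0_iff:
  fixes e :: "nat \<Rightarrow> 'a::comm_monoid_add"
  assumes e: "is_basis p N e" and exp: "\<And>a::'a. nscale p a = 0" and "p > 0"
  shows "lincomb N e c = 0 \<longleftrightarrow> (\<forall>l\<in>{1..N}. p dvd c l)"
proof
  assume "lincomb N e c = 0"
  moreover have "lincomb N e (\<lambda>l\<in>{1..N}. c l mod p) = lincomb N e c"
    by (simp only: lincomb_restrict lincomb_mod[OF exp])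
  moreover have "lincomb N e (\<lambda>l\<in>{1..N}. 0) = 0"
    by (simp add: lincomb_def)
  ultimately have "lincomb N e (\<lambda>l\<in>{1..N}. c l mod p) = lincomb N e (\<lambda>l\<in>{1..N}. 0)"
    by simp
  then have "(\<lambda>l\<in>{1..N}. c l mod p) = (\<lambda>l\<in>{1..N}. 0)"
    using e \<open>p > 0\<close> unfolding is_basis_def bij_betw_def by (elim conjE inj_onD) auto
  then show "\<forall>l\<in>{1..N}. p dvd c l"
    by (metis mod_0_imp_dvd restrict_apply')
next
  assume "\<forall>l\<in>{1..N}. p dvd c l"
  then have "lincomb N e c = lincomb N e (\<lambda>l. p * (c l div p))"
    by (intro lincomb_cong) simp
  then show "lincomb N e c = 0"
    by (simp add: lincomb_mult exp)
qed

section \<open>Exponent and structure of the additive group\<close>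

lemma group_additive_group: "group (additive_group :: 'a::ab_group_add monoid)"
proof (rule groupI)
  show "\<exists>y\<in>carrier additive_group. y \<otimes>\<^bsub>additive_group\<^esub> x = \<one>\<^bsub>additive_group\<^esub>" for x :: 'a
    by (rule bexI[of _ "- x"]) (simp_all add: additive_group_def)
qed (simp_all add: additive_group_def add.assoc)

lemma additive_group_pow: "(x :: 'a::ab_group_add) [^]\<^bsub>additive_group\<^esub> (k::nat) = nscale k x"
  unfolding nat_pow_def by (induction k) (simp_all add: additive_group_def)

text \<open>The order of the finite group is a valid exponent by Lagrange, so the
  \<open>LEAST\<close> is attained.\<close>

lemma group_exponent_additive_group:
  fixes k :: nat
  assumes "group_exponent (additive_group :: 'a::{ab_group_add,finite} monoid) = k"
  shows "nscale k (a :: 'a) = 0" and "\<And>j. 0 < j \<Longrightarrow> (\<And>a::'a. nscale j a = 0) \<Longrightarrow> k \<le> j"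
proof -
  let ?P = "\<lambda>k. 0 < k \<and> (\<forall>x::'a. nscale k x = 0)"
  have k: "k = (LEAST k. ?P k)"
    using assms by (simp add: group_exponent_def additive_group_pow) (simp add: additive_group_def)
  interpret group "additive_group :: 'a monoid"
    by (rule group_additive_group)
  have "?P (order (additive_group :: 'a monoid))"
  proof (intro conjI allI)
    show "0 < order (additive_group :: 'a monoid)"
      by (simp add: order_def additive_group_def card_gt_0_iff)
    show "nscale (order (additive_group :: 'a monoid)) x = 0" for x :: 'a
      using pow_order_eq_1[of x] by (simp add: additive_group_pow) (simp add: additive_group_def)
  qed
  then have "?P k"
    unfolding k by (rule LeastI)
  then show "nscale k a = 0"
    by simp
  show "\<And>j. 0 < j \<Longrightarrow> (\<And>a::'a. nscale j a = 0) \<Longrightarrow> k \<le> j"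
    unfolding k by (rule Least_le) simp
qed

text \<open>The isomorphism is built from right to left: \<open>lincomb\<close> does not notice the
  reduction modulo \<open>p\<close> in the product group. The map \<open>?nat\<close> only converts
  integer residues to natural numbers.\<close>

lemma basis_iso:
  fixes e :: "nat \<Rightarrow> 'a::ab_group_add"
  assumes e: "is_basis p N e" and exp: "\<And>a::'a. nscale p a = 0" and "p > 0"
  shows "(additive_group :: 'a monoid) \<cong> product_group {1..N} (\<lambda>_. integer_mod_group p)"
proof (rule group.iso_sym)
  let ?G = "product_group {1..N} (\<lambda>_. integer_mod_group p)"
  let ?B = "{1..N} \<rightarrow>\<^sub>E {..<p}"
  let ?nat = "\<lambda>c. \<lambda>l\<in>{1..N}. nat (c l)"
  let ?h = "\<lambda>c. lincomb N e (?nat c)"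
  have carrier: "carrier ?G = {1..N} \<rightarrow>\<^sub>E {0..<int p}"
    using \<open>p > 0\<close> by (simp add: carrier_integer_mod_group)
  show "group ?G"
    by simp
  have "bij_betw ?nat (carrier ?G) ?B"
    unfolding carrier
    by (rule bij_betw_byWitness[where f' = "\<lambda>c. \<lambda>l\<in>{1..N}. int (c l)"])
       (auto simp: PiE_iff fun_eq_iff restrict_def extensional_def nat_less_iff)
  then have "bij_betw (lincomb N e \<circ> ?nat) (carrier ?G) UNIV"
    using e unfolding is_basis_def by (rule bij_betw_trans)
  then have bij: "bij_betw ?h (carrier ?G) (carrier (additive_group :: 'a monoid))"
    by (simp add: o_def additive_group_def)
  have hom: "?h (c \<otimes>\<^bsub>?G\<^esub> c') = ?h c + ?h c'" if c: "c \<in> carrier ?G" "c' \<in> carrier ?G" for c c'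
  proof -
    have "?h (c \<otimes>\<^bsub>?G\<^esub> c') = lincomb N e (\<lambda>l. (?nat c l + ?nat c' l) mod p)"
    proof (rule lincomb_cong)
      fix l assume l: "l \<in> {1..N}"
      then have "0 \<le> c l" "0 \<le> c' l"
        using c unfolding carrier by (auto simp: PiE_iff)
      then show "?nat (c \<otimes>\<^bsub>?G\<^esub> c') l = (?nat c l + ?nat c' l) mod p"
        using l by (simp add: nat_mod_distrib nat_add_distrib)
    qed
    then show ?thesis
      by (simp only: lincomb_mod[OF exp] lincomb_add)
  qed
  have "?h \<in> iso ?G additive_group"
    using bij hom by (intro isoI homI) (auto simp: additive_group_def)
  then show "?G \<cong> (additive_group :: 'a monoid)"
    by (rule is_isoI)
qed

section \<open>Polynomial functions in coordinates\<close>

text \<open>The coordinates \<open>F l\<close> are lifts to the natural numbers, not reduced modulo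
  \<open>p\<close>, since reduction would spoil the degree.\<close>

definition coord_poly ::
  "'i set \<Rightarrow> nat \<Rightarrow> (nat \<Rightarrow> 'a::comm_monoid_add) \<Rightarrow> nat \<Rightarrow> (('i \<Rightarrow> nat) \<Rightarrow> 'a) \<Rightarrow> bool" where
  "coord_poly I N e D g \<longleftrightarrow>
    (\<exists>F. (\<forall>l. diff_deg_less I (Suc D) (F l)) \<and> (\<forall>y. g y = lincomb N e (\<lambda>l. F l y)))"

lemma coord_polyI:
  "(\<And>l. diff_deg_less I (Suc D) (F l)) \<Longrightarrow> (\<And>y. g y = lincomb N e (\<lambda>l. F l y)) \<Longrightarrow>
    coord_poly I N e D g"
  unfolding coord_poly_def by blast

lemma coord_polyE:
  assumes "coord_poly I N e D g"
  obtains F where "\<And>l. diff_deg_less I (Suc D) (F l)" "\<And>y. g y = lincomb N e (\<lambda>l. F l y)"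
  using assms unfolding coord_poly_def by blast

lemma coord_poly_mono: "coord_poly I N e D g \<Longrightarrow> D \<le> E \<Longrightarrow> coord_poly I N e E g"
  by (erule coord_polyE, rule coord_polyI, rule diff_deg_less_mono[of "Suc D"])
     (simp_all only: Suc_le_mono)

lemma coord_poly_const:
  assumes "is_basis p N e"
  shows "coord_poly I N e D (\<lambda>_. a)"
proof -
  obtain c where "a = lincomb N e c"
    using basis_surj[OF assms] .
  then show ?thesis
    by (intro coord_polyI[where F = "\<lambda>l _. c l"] diff_deg_less_const)
qed

lemma coord_poly_coordinate: "coord_poly I N e (Suc D) (\<lambda>y. lincomb N e (\<lambda>l. y (i, l)))"
  by (intro coord_polyI[where F = "\<lambda>l y. y (i, l)"] diff_deg_less_coordinate refl)

lemma coord_poly_sum: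
  assumes "\<And>x. x \<in> A \<Longrightarrow> coord_poly I N e D (g x)"
  shows "coord_poly I N e D (\<lambda>y. \<Sum>x\<in>A. g x y)"
proof -
  have "\<exists>F. \<forall>x\<in>A. (\<forall>l. diff_deg_less I (Suc D) (F x l)) \<and> (\<forall>y. g x y = lincomb N e (\<lambda>l. F x l y))"
    using assms unfolding coord_poly_def by (intro bchoice) blast
  then obtain F where "\<And>x l. x \<in> A \<Longrightarrow> diff_deg_less I (Suc D) (F x l)"
    "\<And>x y. x \<in> A \<Longrightarrow> g x y = lincomb N e (\<lambda>l. F x l y)"
    by blast
  then show ?thesis
    by (intro coord_polyI[where F = "\<lambda>l y. \<Sum>x\<in>A. F x l y"])
       (auto simp: lincomb_sum intro: diff_deg_less_sum simp del: diff_deg_less.simps)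
qed

text \<open>With structure constants \<gamma> of the rng, the coordinates of a product are bilinear
  in those of the factors.\<close>

lemma coord_poly_mult:
  fixes e :: "nat \<Rightarrow> 'a::Rings.ring"
  assumes e: "is_basis p N e" and "coord_poly I N e a g" "coord_poly I N e b h"
  shows "coord_poly I N e (a + b) (\<lambda>y. g y * h y)"
proof -
  obtain F where F: "\<And>l. diff_deg_less I (Suc a) (F l)" "\<And>y. g y = lincomb N e (\<lambda>l. F l y)"
    using assms(2) by (rule coord_polyE) blast
  obtain G where G: "\<And>l. diff_deg_less I (Suc b) (G l)" "\<And>y. h y = lincomb N e (\<lambda>l. G l y)"
    using assms(3) by (rule coord_polyE) blast
  have "\<forall>l m. \<exists>c. e l * e m = lincomb N e c"
    using basis_surj[OF e] by metis
  then obtain \<gamma> where \<gamma>: "\<And>l m. e l * e m = lincomb N e (\<gamma> l m)"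
    by metis
  have FG: "diff_deg_less I (Suc (a + b)) (\<lambda>y. F l y * G m y)" for l m
    using F(1) G(1) by (rule diff_deg_less_mult)
  have "g y * h y = lincomb N e (\<lambda>k. \<Sum>l=1..N. \<Sum>m=1..N. F l y * G m y * \<gamma> l m k)" for y
  proof -
    have "g y * h y = (\<Sum>l=1..N. \<Sum>m=1..N. nscale (F l y * G m y) (e l * e m))"
      unfolding F(2) G(2) by (simp add: lincomb_def sum_product nscale_mult_nscale)
    then show ?thesis
      by (simp only: \<gamma> lincomb_sum lincomb_mult)
  qed
  moreover have "diff_deg_less I (Suc (a + b))
      (\<lambda>y. \<Sum>l=1..N. \<Sum>m=1..N. F l y * G m y * \<gamma> l m k)" for k
    using diff_deg_less_mult[OF FG diff_deg_less_const[of I 0]] by (intro diff_deg_less_sum) simp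
  ultimately show ?thesis
    by (intro coord_polyI[where F = "\<lambda>k y. \<Sum>l=1..N. \<Sum>m=1..N. F l y * G m y * \<gamma> l m k"])
qed

lemma coord_poly_times_power:
  fixes e :: "nat \<Rightarrow> 'a::Rings.ring"
  assumes e: "is_basis p N e" and "coord_poly I N e a g" "coord_poly I N e 1 x"
  shows "coord_poly I N e (a + d) (\<lambda>y. times_power (g y) (x y) d)"
proof (induction d)
  case (Suc d)
  then show ?case
    using coord_poly_mult[OF e Suc assms(3)] by (simp add: times_power_def)
qed (simp add: times_power_def assms)

text \<open>Each further variable multiplies on the right by functions of degree 1, as often as its
  exponent says.\<close>

lemma coord_poly_eval_term:
  fixes e :: "nat \<Rightarrow> 'a::Rings.ring"
  assumes e: "is_basis p N e" and x: "\<And>i. coord_poly I N e 1 (\<lambda>y. x y i)"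
  shows "coord_poly I N e (\<Sum>i=1..n. Poly_Mapping.lookup m i) (\<lambda>y. eval_term n c m (x y))"
proof (induction n)
  case 0
  show ?case
    using coord_poly_const[OF e] by (simp add: eval_term_def)
next
  case (Suc n)
  show ?case
    using coord_poly_times_power[OF e Suc x] by (simp add: eval_term_def)
qed

lemma coord_poly_eval_mpoly:
  fixes e :: "nat \<Rightarrow> 'a::Rings.ring"
  assumes e: "is_basis p N e" and x: "\<And>i. coord_poly I N e 1 (\<lambda>y. x y i)" and f: "f \<in> mpolys n"
  shows "coord_poly I N e (total_degree f) (\<lambda>y. eval_mpoly n f (x y))"
  unfolding eval_mpoly_def
proof (rule coord_poly_sum)
  fix m assume m: "m \<in> Poly_Mapping.keys f"
  have "(\<Sum>i=1..n. Poly_Mapping.lookup m i) = (\<Sum>i\<in>Poly_Mapping.keys m. Poly_Mapping.lookup m i)"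
    using f m by (intro sum.mono_neutral_right) (auto simp: mpolys_def in_keys_iff)
  also have "\<dots> \<le> total_degree f"
    unfolding total_degree_def using m by (intro Max_ge) auto
  finally show "coord_poly I N e (total_degree f) (\<lambda>y. eval_term n (Poly_Mapping.lookup f m) m (x y))"
    using coord_poly_eval_term[OF e x] by (rule coord_poly_mono[rotated])
qed

text \<open>Only the monomial 0 occurs, and its coefficient is the constant value.\<close>

lemma eval_mpoly_total_degree_0:
  fixes f :: "'a::Rings.ring mpoly"
  assumes "total_degree f = 0" "f \<noteq> 0"
  shows "eval_mpoly n f x \<noteq> 0"
proof -
  have "m = 0" if m: "m \<in> Poly_Mapping.keys f" for m
  proof -
    have "(\<Sum>i\<in>Poly_Mapping.keys m. Poly_Mapping.lookup m i) \<le> total_degree f"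
      unfolding total_degree_def using m by (intro Max_ge) auto
    then show ?thesis
      using assms by (metis finite_keys in_keys_iff keys_eq_empty le_zero_eq sum_eq_0_iff equals0I)
  qed
  moreover have "Poly_Mapping.keys f \<noteq> {}"
    using assms by simp
  ultimately have keys: "Poly_Mapping.keys f = {0}"
    by blast
  have "eval_term n c 0 x = c" for c
    by (induction n) (simp_all add: eval_term_def times_power_def)
  then show ?thesis
    using keys by (simp add: eval_mpoly_def in_keys_iff[symmetric])
qed

section \<open>Counting the common zeros\<close>

lemma card_zero_locus_dvd:
  fixes f :: "nat \<Rightarrow> 'a::{Rings.ring,finite} mpoly" and e :: "nat \<Rightarrow> 'a"
  assumes p: "Factorial_Ring.prime p" and e: "is_basis p N e" and exp: "\<And>a::'a. nscale p a = 0"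
    and f: "\<And>j. j \<in> {1..r} \<Longrightarrow> f j \<in> mpolys n"
    and D: "\<And>j. j \<in> {1..r} \<Longrightarrow> total_degree (f j) \<le> D" and "0 < D"
    and bound: "D * \<mu> + N * (\<Sum>j=1..r. total_degree (f j)) < N * n + D"
  shows "p ^ \<mu> dvd card (zero_locus n r f)"
proof -
  let ?I = "{1..n} \<times> {1..N}" and ?J = "{1..r} \<times> {1..N}"
  let ?Y = "?I \<rightarrow>\<^sub>E {..<p}"
  define x where "x y i = lincomb N e (\<lambda>l. y (i, l))" for y :: "nat \<times> nat \<Rightarrow> nat" and i :: nat
  have "coord_poly ?I N e 1 (\<lambda>y. x y i)" for i
    unfolding x_def One_nat_def by (rule coord_poly_coordinate)
  then have "\<forall>j\<in>{1..r}. coord_poly ?I N e (total_degree (f j)) (\<lambda>y. eval_mpoly n (f j) (x y))"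
    using coord_poly_eval_mpoly[OF e _ f] by blast
  then have "\<exists>F. \<forall>j\<in>{1..r}. (\<forall>l. diff_deg_less ?I (Suc (total_degree (f j))) (F j l)) \<and>
      (\<forall>y. eval_mpoly n (f j) (x y) = lincomb N e (\<lambda>l. F j l y))"
    unfolding coord_poly_def by (rule bchoice)
  then obtain F where F: "\<And>j l. j \<in> {1..r} \<Longrightarrow> diff_deg_less ?I (Suc (total_degree (f j))) (F j l)"
    and eval: "\<And>j y. j \<in> {1..r} \<Longrightarrow> eval_mpoly n (f j) (x y) = lincomb N e (\<lambda>l. F j l y)"
    by blast
  \<comment> \<open>Restriction makes the points extensional, as membership in
    \<open>zero_locus\<close> demands; evaluation only reads the indices from 1 to
    \<open>n\<close>.\<close>
  define \<Phi> where "\<Phi> y = (\<lambda>i\<in>{1..n}. x y i)" for y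
  have "bij_betw \<Phi> ?Y ({1..n} \<rightarrow>\<^sub>E UNIV)"
    unfolding bij_betw_def
  proof (intro conjI equalityI subsetI)
    show "inj_on \<Phi> ?Y"
    proof (rule inj_onI)
      fix y y' assume y: "y \<in> ?Y" "y' \<in> ?Y" and eq: "\<Phi> y = \<Phi> y'"
      show "y = y'"
      proof (rule PiE_ext[OF y])
        fix k assume "k \<in> ?I"
        then obtain i l where k: "k = (i, l)" "i \<in> {1..n}" "l \<in> {1..N}"
          by blast
        have "x y i = x y' i"
          using eq k unfolding \<Phi>_def by (metis restrict_apply')
        then have "lincomb N e (\<lambda>l\<in>{1..N}. y (i, l)) = lincomb N e (\<lambda>l\<in>{1..N}. y' (i, l))"
          unfolding x_def by (simp only: lincomb_restrict)
        then have "(\<lambda>l\<in>{1..N}. y (i, l)) = (\<lambda>l\<in>{1..N}. y' (i, l))"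
          using e y k unfolding is_basis_def bij_betw_def
          by (elim conjE inj_onD) (auto simp: PiE_iff)
        then show "y k = y' k"
          using k by (metis restrict_apply')
      qed
    qed
    fix z :: "nat \<Rightarrow> 'a" assume z: "z \<in> {1..n} \<rightarrow>\<^sub>E UNIV"
    have "\<forall>i. \<exists>c. z i = lincomb N e c \<and> c \<in> {1..N} \<rightarrow>\<^sub>E {..<p}"
      using basis_surj[OF e] by metis
    then obtain c where c: "\<And>i. z i = lincomb N e (c i)" "\<And>i. c i \<in> {1..N} \<rightarrow>\<^sub>E {..<p}"
      by metis
    let ?y = "\<lambda>(i, l)\<in>?I. c i l"
    have "\<Phi> ?y = z"
    proof (rule PiE_ext[OF _ z])
      show "\<Phi> ?y i = z i" if "i \<in> {1..n}" for i
        using that unfolding \<Phi>_def x_def c(1)[of i] by (auto intro: lincomb_cong)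
    qed (simp add: \<Phi>_def)
    moreover have "?y \<in> ?Y"
      using c(2) by (auto simp: PiE_iff)
    ultimately show "z \<in> \<Phi> ` ?Y"
      by blast
  qed (auto simp: \<Phi>_def)
  moreover have zero: "\<Phi> y \<in> zero_locus n r f \<longleftrightarrow> (\<forall>k\<in>?J. p dvd (case k of (j, l) \<Rightarrow> F j l) y)"
    if "y \<in> ?Y" for y
  proof -
    have "eval_term n c m (\<Phi> y) = eval_term n c m (x y)" for c m
      unfolding eval_term_def by (rule foldl_cong) (auto simp: \<Phi>_def)
    then have "eval_mpoly n (f j) (\<Phi> y) = 0 \<longleftrightarrow> (\<forall>l\<in>{1..N}. p dvd F j l y)" if "j \<in> {1..r}" for j
      using eval[OF that, of y] basis_lincomb_eq_0_iff[OF e exp prime_gt_0_nat[OF p]]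
      by (simp add: eval_mpoly_def)
    then show ?thesis
      by (auto simp: zero_locus_def \<Phi>_def)
  qed
  ultimately have "bij_betw \<Phi> {y \<in> ?Y. \<forall>k\<in>?J. p dvd (case k of (j, l) \<Rightarrow> F j l) y} (zero_locus n r f)"
    unfolding bij_betw_def
  proof (elim conjE, intro conjI)
    assume inj: "inj_on \<Phi> ?Y" and img: "\<Phi> ` ?Y = {1..n} \<rightarrow>\<^sub>E UNIV"
    let ?S = "{y \<in> ?Y. \<forall>k\<in>?J. p dvd (case k of (j, l) \<Rightarrow> F j l) y}"
    show "inj_on \<Phi> ?S"
      using inj by (rule inj_on_subset) blast
    have "zero_locus n r f \<subseteq> \<Phi> ` ?Y"
      unfolding img by (auto simp: zero_locus_def)
    then show "\<Phi> ` ?S = zero_locus n r f"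
      using zero by blast
  qed
  then have "card (zero_locus n r f) = card {y \<in> ?Y. \<forall>k\<in>?J. p dvd (case k of (j, l) \<Rightarrow> F j l) y}"
    by (simp add: bij_betw_same_card)
  moreover have "p ^ \<mu> dvd card {y \<in> ?Y. \<forall>k\<in>?J. p dvd (case k of (j, l) \<Rightarrow> F j l) y}"
  proof (rule ax_katz_prime_field[OF p, where d = "\<lambda>(j, l). total_degree (f j)" and D = D])
    have "(\<Sum>(j, l)\<in>?J. total_degree (f j)) = N * (\<Sum>j=1..r. total_degree (f j))"
      by (simp add: sum.cartesian_product[symmetric] sum_distrib_left)
    then show "D * \<mu> + (\<Sum>(j, l)\<in>?J. total_degree (f j)) < card ?I + D"
      using bound by (simp add: mult.commute)
  qed (use F D \<open>0 < D\<close> in \<open>auto simp del: diff_deg_less.simps\<close>)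
  ultimately show ?thesis
    by simp
qed

theorem theorem1p3:
  fixes p n r :: nat
    and f :: "nat \<Rightarrow> 'a::{Rings.ring, finite} mpoly"
  assumes "Factorial_Ring.prime p"
    and "group_exponent (additive_group :: 'a monoid) = p"
    and "0 < n" and "0 < r"
    and "\<And>j. j \<in> {1..r} \<Longrightarrow> f j \<in> mpolys n"
    and "\<And>j. j \<in> {1..r} \<Longrightarrow> f j \<noteq> 0"
  shows "\<exists>N>0.
      (additive_group :: 'a monoid) \<cong> product_group {1..N} (\<lambda>_. integer_mod_group p) \<and>
      ord_p p (card (zero_locus n r f)) \<ge>
        ceil_quotient
          (real N * (real n - (\<Sum>j=1..r. real (total_degree (f j)))))
          (MAX j\<in>{1..r}. total_degree (f j))"
proof -
  note p = assms(1)
  have exp: "nscale p a = 0" for a :: 'a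
    by (rule group_exponent_additive_group(1)[OF assms(2)])
  obtain N and e :: "nat \<Rightarrow> 'a" where e: "is_basis p N e"
    using ex_basis[OF p exp] .
  \<comment> \<open>For \<open>N = 0\<close> the rng would be trivial and its exponent 1.\<close>
  have "N > 0"
  proof (rule ccontr)
    assume "\<not> N > 0"
    then have "a = 0" for a :: 'a
      using basis_surj[OF e, of a] by (auto simp: lincomb_def)
    then have "p \<le> 1"
      by (intro group_exponent_additive_group(2)[OF assms(2)]) auto
    then show False
      using prime_gt_1_nat[OF p] by simp
  qed
  define D where "D = (MAX j\<in>{1..r}. total_degree (f j))"
  define A where "A = real N * (real n - (\<Sum>j=1..r. real (total_degree (f j))))"
  have D: "total_degree (f j) \<le> D" if "j \<in> {1..r}" for j
    unfolding D_def using that by (intro Max_ge) auto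
  have "ceil_quotient A D \<le> ord_p p (card (zero_locus n r f))"
  proof (cases "card (zero_locus n r f) = 0")
    case False
    \<comment> \<open>For \<open>D = 0\<close> the polynomial \<open>f 1\<close> is a nonzero
      constant, so the zero locus is empty, contrary to the case assumption.\<close>
    have "D > 0"
    proof (rule ccontr)
      assume "\<not> D > 0"
      moreover have "1 \<in> {1..r}"
        using \<open>0 < r\<close> by simp
      ultimately have "zero_locus n r f = {}"
        using D[of 1] assms(6)[of 1] eval_mpoly_total_degree_0[of "f 1"]
        by (fastforce simp: zero_locus_def)
      with False show False
        by simp
    qed
    \<comment> \<open>A negative ceiling is cut off to 0, where divisibility is trivial; for
      positive \<mu> the ceiling yields \<mu> \<open>< A / D + 1\<close>.\<close>
    define \<mu> where "\<mu> = nat \<lceil>A / real D\<rceil>"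
    have "p ^ \<mu> dvd card (zero_locus n r f)"
    proof (cases "\<mu> = 0")
      case False
      then have "real \<mu> < A / real D + 1"
        unfolding \<mu>_def by linarith
      then have "real D * real \<mu> < A + real D"
        using \<open>D > 0\<close> by (simp add: field_simps)
      then have "real (D * \<mu> + N * (\<Sum>j=1..r. total_degree (f j))) < real (N * n + D)"
        unfolding A_def by (simp add: algebra_simps)
      then have "D * \<mu> + N * (\<Sum>j=1..r. total_degree (f j)) < N * n + D"
        by (simp only: of_nat_less_iff)
      with p e exp assms(5) D \<open>D > 0\<close> show ?thesis
        by (rule card_zero_locus_dvd)
    qed simp
    then have "\<mu> \<le> multiplicity p (card (zero_locus n r f))"
      using False p by (intro multiplicity_geI) auto
    then have "real_of_int \<lceil>A / real D\<rceil> \<le> real (multiplicity p (card (zero_locus n r f)))"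
      unfolding \<mu>_def by linarith
    then show ?thesis
      using False \<open>D > 0\<close> by (simp add: ceil_quotient_def ord_p_def)
  qed (simp add: ord_p_def)
  then show ?thesis
    using \<open>N > 0\<close> basis_iso[OF e exp prime_gt_0_nat[OF p]] unfolding A_def D_def by blast
qed

end
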